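(* Let $(E,\mathcal E,\mu)$ be a probability space, let $w\ge 0$ be a measurable function on $E$, let $\alpha>1$, $\beta=\frac{\alpha}{\alpha-1}$ and $\beta^*=\max(\beta,2)$. Then for every probability measure $\nu$ on $(E,\mathcal E)$, $$\|w(\nu-\mu)\|_{\rm TV}\le C_\beta\,\|w\|_{2\beta^*-2}\,\sqrt{T_\alpha(\nu\|\mu)},$$ where one may take $C_\beta=2$ for $\alpha\ge 2$ and $C_\beta=4\,\beta^\beta$ for $\alpha<2$.
   Context: The Rényi divergence power (Tsallis distance) of order $\alpha>1$ is $T_\alpha(\nu\|\mu)=\frac{1}{\alpha-1}\left[\int f^\alpha\,d\mu-1\right]$ if $\nu$ is absolutely continuous with respect to $\mu$ with density $f=d\nu/d\mu$ (value $+\infty$ allowed), and $T_\alpha(\nu\|\mu)=\infty$ otherwise. The weighted total variation distance is $\|w(\nu-\mu)\|_{\rm TV}=\int w\,d|\nu-\mu|$, which equals $\int w\,|f-1|\,d\mu$ when $\nu$ has density $f$ with respect to $\mu$. $\|u\|_p=\left(\int|u|^p\,d\mu\right)^{1/p}$ (possibly $+\infty$). If one of the factors on the right-hand side is $+\infty$, the right-hand side is read as $+\infty$ and the inequality is trivial. *)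

theory Defs
  imports "HOL-Probability.Probability"
begin

text \<open>
  Total variation measure of the signed measure \<open>\<nu> - \<mu>\<close> for finite measures on the same
  sigma-algebra: the supremum of \<open>\<Sum>\<bar>\<nu> B - \<mu> B\<bar>\<close> over finite measurable partitions. No absolute
  continuity is presupposed.
\<close>
definition total_variation_diff :: "'a measure \<Rightarrow> 'a measure \<Rightarrow> 'a measure" where
  "total_variation_diff \<nu> \<mu> = measure_of (space \<mu>) (sets \<mu>)
     (\<lambda>A. SUP P \<in> {P. finite P \<and> P \<subseteq> sets \<mu> \<and> partition_on A P}.
            \<Sum>B\<in>P. ennreal \<bar>measure \<nu> B - measure \<mu> B\<bar>)"

definition weighted_TV :: "('a \<Rightarrow> real) \<Rightarrow> 'a measure \<Rightarrow> 'a measure \<Rightarrow> ennreal" where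
  "weighted_TV w \<nu> \<mu> = (\<integral>\<^sup>+ x. ennreal (w x) \<partial>total_variation_diff \<nu> \<mu>)"

text \<open>
  The density takes values in \<^typ>\<open>ennreal\<close>, but for finite \<open>\<nu>\<close> it is finite \<open>\<mu>\<close>-almost everywhere,
  so passing to real values does not change the integral.
\<close>
definition renyi_power :: "real \<Rightarrow> 'a measure \<Rightarrow> 'a measure \<Rightarrow> ereal" where
  "renyi_power \<alpha> \<nu> \<mu> =
     (if absolutely_continuous \<mu> \<nu>
      then ereal (1 / (\<alpha> - 1)) *
           (enn2ereal (\<integral>\<^sup>+ x. ennreal (enn2real (RN_deriv \<mu> \<nu> x) powr \<alpha>) \<partial>\<mu>) - 1)
      else \<infinity>)"

definition Lp_norm :: "real \<Rightarrow> 'a measure \<Rightarrow> ('a \<Rightarrow> real) \<Rightarrow> ennreal" where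
  "Lp_norm p \<mu> u =
     (let I = (\<integral>\<^sup>+ x. ennreal (\<bar>u x\<bar> powr p) \<partial>\<mu>)
      in if I = \<infinity> then \<infinity> else ennreal (enn2real I powr (1 / p)))"

text \<open>
  The product \<open>C a \<surd>t\<close> of extended nonnegative factors, with value \<open>\<infinity>\<close> as soon as \<open>a\<close> or \<open>t\<close> is
  infinite; in particular \<open>0 \<cdot> \<infinity>\<close> is read as \<open>\<infinity>\<close>, unlike in \<^typ>\<open>ennreal\<close> and \<^typ>\<open>ereal\<close>.
\<close>
definition bound_rhs :: "real \<Rightarrow> ennreal \<Rightarrow> ereal \<Rightarrow> ennreal" where
  "bound_rhs C a t =
     (if a = \<infinity> \<or> t = \<infinity> then \<infinity> else ennreal (C * enn2real a * sqrt (real_of_ereal t)))"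

end

theory Submission imports Defs begin

text \<open>
  Let \<open>f\<close> be the density of \<open>\<nu>\<close> and \<open>g(f) = (f\<^sup>\<alpha> - 1 - \<alpha>(f - 1)) / (\<alpha> - 1)\<close>. Since \<open>\<integral> f d\<mu> = 1\<close>, the
  divergence power is \<open>T = \<integral> g(f) d\<mu>\<close>, and \<open>g \<ge> 0\<close> vanishes to second order at \<open>f = 1\<close>. For
  \<open>\<alpha> \<ge> 2\<close> it dominates \<open>(f - 1)\<^sup>2\<close> everywhere and the theorem is the Cauchy-Schwarz inequality.
  For \<open>\<alpha> < 2\<close> it grows only like \<open>f\<^sup>\<alpha>\<close>, so the domination fails for large \<open>f\<close>.
  With \<open>c = max 0 (2 - \<alpha>)\<close> the bound that holds for every \<open>\<alpha> > 1\<close> is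
  \<open>(f - 1)\<^sup>2 \<le> 2 (1 + f)\<^sup>c g(f)\<close> (lemma \<open>square_le_powr_generator\<close>).

  The factor \<open>(1 + f)\<^sup>c\<close> is moved to the weight: by Cauchy-Schwarz,
  \<open>(\<integral> w \<bar>f - 1\<bar> d\<mu>)\<^sup>2 \<le> \<integral> w\<^sup>2 (1 + f)\<^sup>c d\<mu> \<cdot> \<integral> (f - 1)\<^sup>2 (1 + f)\<^sup>-\<^sup>c d\<mu>\<close>, where the second
  integral is at most \<open>2 T\<close>. Because \<open>1 + f\<close> has integral \<open>2\<close>, Hoelder's inequality with exponents
  \<open>1 / (1 - c)\<close> and \<open>1 / c\<close> bounds the first one by \<open>2\<^sup>c\<close> times the square of the norm of \<open>w\<close> of
  order \<open>2 / (1 - c)\<close>. This order is exactly \<open>2\<beta>\<^sup>* - 2\<close>, namely \<open>2\<close> if \<open>\<alpha> \<ge> 2\<close> and \<open>2 / (\<alpha> - 1)\<close>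
  if \<open>\<alpha> < 2\<close>. As \<open>c \<le> 1\<close>, the resulting constant is \<open>2\<close> for every \<open>\<alpha>\<close>, and \<open>2 \<le> 4\<beta>\<^sup>\<beta>\<close>
  (lemma \<open>weighted_L1_le_powr_divergence\<close>).

  The weighted total variation is compared with \<open>\<integral> w \<bar>f - 1\<bar> d\<mu>\<close> by \<open>weighted_TV_le_density\<close>.
\<close>

section \<open>A pointwise bound for the generator of the divergence\<close>

lemma Bernoulli_inequality_powr:
  fixes x p :: real
  assumes "x > 0" "p \<ge> 1"
  shows "1 + p * (x - 1) \<le> x powr p"
proof -
  have "((\<lambda>x. x powr p) has_field_derivative p) (at 1 within {0<..})"
    by (auto intro!: derivative_eq_intros)
  with convex_on_imp_above_tangent[OF powr_convex[OF \<open>p \<ge> 1\<close>], of 1 x p]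
  show ?thesis using \<open>x > 0\<close> by (simp add: interior_open)
qed

text \<open>
  By Taylor's formula at \<open>1\<close> the right-hand side is \<open>a (a - 1) / 2 \<cdot> (x - 1)\<^sup>2 \<cdot> t powr (a - 2)\<close> for some
  \<open>t\<close> between \<open>1\<close> and \<open>x\<close>. The exponent \<open>a - 2\<close> is not positive, so \<open>t \<le> 1 + x\<close> gives the bound.
\<close>
lemma powr_Taylor_quadratic_lower:
  fixes x a :: real
  assumes "x > 0" "1 \<le> a" "a \<le> 2"
  shows "a * (a - 1) / 2 * (x - 1)\<^sup>2 * (1 + x) powr (a - 2) \<le> x powr a - 1 - a * (x - 1)"
proof (cases "x = 1")
  case False
  define D :: "nat \<Rightarrow> real \<Rightarrow> real" where
    "D m t = (if m = 0 then t powr a else if m = 1 then a * t powr (a - 1)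
              else a * (a - 1) * t powr (a - 2))" for m t
  have D0: "D 0 = (\<lambda>t. t powr a)" by (auto simp: D_def)
  have der: "DERIV (D m) t :> D (Suc m) t" if "m < 2" "min x 1 \<le> t" for m t
  proof -
    have "t > 0" using that \<open>x > 0\<close> by linarith
    from \<open>m < 2\<close> consider "m = 0" | "m = 1" by linarith
    then show ?thesis
    proof cases
      case 1
      then have "D m = (\<lambda>t. t powr a)" by (auto simp: D_def)
      with 1 \<open>t > 0\<close> show ?thesis
        by (auto simp: D_def intro!: derivative_eq_intros)
    next
      case 2
      then have "D m = (\<lambda>t. a * t powr (a - 1))" by (auto simp: D_def)
      with 2 \<open>t > 0\<close> show ?thesis
        by (auto simp: D_def intro!: derivative_eq_intros)
    qed
  qed
  obtain t where t: "if x < 1 then x < t \<and> t < 1 else 1 < t \<and> t < x"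
    and eq: "x powr a = (\<Sum>m<2. (D m 1 / fact m) * (x - 1)^m) + (D 2 t / fact 2) * (x - 1)^2"
    using Taylor[of 2 D "\<lambda>t. t powr a" "min x 1" "max x 1" 1 x] False der D0 by auto
  from t \<open>x > 0\<close> have "0 < t" "t \<le> 1 + x" by (auto split: if_splits)
  then have "(1 + x) powr (a - 2) \<le> t powr (a - 2)"
    using \<open>a \<le> 2\<close> by (intro powr_mono2') auto
  then have "a * (a - 1) / 2 * (x - 1)\<^sup>2 * (1 + x) powr (a - 2)
      \<le> a * (a - 1) / 2 * (x - 1)\<^sup>2 * t powr (a - 2)"
    using \<open>1 \<le> a\<close> by (intro mult_left_mono) auto
  also have "\<dots> = x powr a - 1 - a * (x - 1)"
    unfolding eq by (simp add: D_def numeral_2_eq_2 field_simps)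
  finally show ?thesis .
qed simp

text \<open>
  For \<open>a \<ge> 2\<close>, \<open>x\<close> times Bernoulli's inequality for the exponent \<open>a - 1\<close> gives even
  \<open>(a - 1) (x - 1)\<^sup>2 \<le> x powr a - 1 - a (x - 1)\<close>. For \<open>a < 2\<close> the second derivative decays like
  \<open>x powr (a - 2)\<close>, and the factor \<open>(1 + x) powr (2 - a)\<close> compensates exactly this decay.
\<close>
lemma square_le_powr_generator:
  fixes x a :: real
  assumes "x \<ge> 0" "a > 1"
  shows "(x - 1)\<^sup>2 \<le> 2 * (1 + x) powr max 0 (2 - a) * ((x powr a - 1 - a * (x - 1)) / (a - 1))"
proof -
  consider "x = 0" | "x > 0" "a \<ge> 2" | "x > 0" "a < 2" using \<open>x \<ge> 0\<close> by linarith
  then show ?thesis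
  proof cases
    case 1
    then show ?thesis using \<open>a > 1\<close> by simp
  next
    case 2
    have "x * (1 + (a - 1) * (x - 1)) \<le> x * x powr (a - 1)"
      using 2 Bernoulli_inequality_powr[of x "a - 1"] by (intro mult_left_mono) auto
    also have "\<dots> = x powr a" using \<open>x > 0\<close> by (simp add: powr_diff)
    finally have "(a - 1) * (x - 1)\<^sup>2 \<le> x powr a - 1 - a * (x - 1)"
      by (simp add: algebra_simps power2_eq_square)
    then have "(x - 1)\<^sup>2 \<le> (x powr a - 1 - a * (x - 1)) / (a - 1)"
      using \<open>a > 1\<close> by (simp add: field_simps)
    moreover have "0 \<le> (x - 1)\<^sup>2" by simp
    ultimately have "(x - 1)\<^sup>2 \<le> 2 * ((x powr a - 1 - a * (x - 1)) / (a - 1))" by linarith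
    moreover have "(1 + x) powr max 0 (2 - a) = 1" using 2 by (simp add: max.absorb1)
    ultimately show ?thesis by simp
  next
    case 3
    have "a * (a - 1) / 2 * (x - 1)\<^sup>2 * (1 + x) powr (a - 2) \<le> x powr a - 1 - a * (x - 1)"
      using powr_Taylor_quadratic_lower[of x a] 3 \<open>a > 1\<close> by simp
    then have *: "a / 2 * (x - 1)\<^sup>2 * (1 + x) powr (a - 2) \<le> (x powr a - 1 - a * (x - 1)) / (a - 1)"
      using \<open>a > 1\<close> by (simp add: pos_le_divide_eq mult_ac)
    have "(1 + x) powr (2 - a) * (1 + x) powr (a - 2) = 1"
      using \<open>x > 0\<close> by (simp flip: powr_add)
    then have "a * (x - 1)\<^sup>2 = 2 * (1 + x) powr (2 - a) * (a / 2 * (x - 1)\<^sup>2 * (1 + x) powr (a - 2))"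
      by (simp add: mult_ac)
    also have "\<dots> \<le> 2 * (1 + x) powr (2 - a) * ((x powr a - 1 - a * (x - 1)) / (a - 1))"
      using * by (intro mult_left_mono) auto
    finally have "a * (x - 1)\<^sup>2 \<le> 2 * (1 + x) powr (2 - a) * ((x powr a - 1 - a * (x - 1)) / (a - 1))" .
    moreover have "1 * (x - 1)\<^sup>2 \<le> a * (x - 1)\<^sup>2"
      using \<open>a > 1\<close> by (intro mult_right_mono) auto
    ultimately show ?thesis using 3 by (simp add: max_def)
  qed
qed

section \<open>Hoelder's inequality\<close>

text \<open>
  After dividing \<open>u\<close> and \<open>v\<close> by their integrals, Young's inequality bounds the integrand by a convex
  combination of two functions of integral \<open>1\<close>. With \<open>u\<close> and \<open>v\<close> themselves integrable, instead of
  their powers with the conjugate exponents \<open>1 / (1 - c)\<close> and \<open>1 / c\<close>, the end point \<open>c = 0\<close> is included.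
\<close>
lemma nn_integral_Holder_powr:
  fixes u v :: "'a \<Rightarrow> real"
  assumes u: "integrable M u" "\<And>x. x \<in> space M \<Longrightarrow> 0 \<le> u x"
    and v: "integrable M v" "\<And>x. x \<in> space M \<Longrightarrow> 0 \<le> v x"
    and c: "0 \<le> c" "c \<le> 1"
  shows "(\<integral>\<^sup>+x. ennreal (u x powr (1 - c) * v x powr c) \<partial>M)
    \<le> ennreal ((\<integral>x. u x \<partial>M) powr (1 - c) * (\<integral>x. v x \<partial>M) powr c)"
proof -
  define U where "U = (\<integral>x. u x \<partial>M)"
  define V where "V = (\<integral>x. v x \<partial>M)"
  have "U \<ge> 0" "V \<ge> 0" unfolding U_def V_def using u v by (auto intro!: integral_nonneg_AE)
  show ?thesis
  proof (cases "U = 0 \<or> V = 0")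
    case True
    then have "AE x in M. u x = 0 \<or> v x = 0"
    proof
      assume "U = 0"
      then have "AE x in M. u x = 0"
        using u integral_nonneg_eq_0_iff_AE[of M u] by (auto simp: U_def)
      then show ?thesis by auto
    next
      assume "V = 0"
      then have "AE x in M. v x = 0"
        using v integral_nonneg_eq_0_iff_AE[of M v] by (auto simp: V_def)
      then show ?thesis by auto
    qed
    then have "(\<integral>\<^sup>+x. ennreal (u x powr (1 - c) * v x powr c) \<partial>M) = (\<integral>\<^sup>+x. 0 \<partial>M)"
      by (intro nn_integral_cong_AE) auto
    then show ?thesis by simp
  next
    case False
    with \<open>U \<ge> 0\<close> \<open>V \<ge> 0\<close> have pos: "U > 0" "V > 0" by auto
    define K where "K = U powr (1 - c) * V powr c"
    have pw: "u x powr (1 - c) * v x powr c \<le> K * ((1 - c) * (u x / U) + c * (v x / V))"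
      if "x \<in> space M" for x
    proof (cases "u x = 0 \<or> v x = 0")
      case True
      then show ?thesis using that u(2) v(2) c pos by (auto simp: K_def)
    next
      case False
      then have "u x > 0" "v x > 0" using that u(2)[of x] v(2)[of x] by auto
      then have "(u x / U) powr (1 - c) * (v x / V) powr c \<le> (1 - c) * (u x / U) + c * (v x / V)"
        using pos c by (intro Youngs_inequality_0) auto
      then have "K * ((u x / U) powr (1 - c) * (v x / V) powr c)
          \<le> K * ((1 - c) * (u x / U) + c * (v x / V))"
        by (intro mult_left_mono) (auto simp: K_def)
      moreover have "K * ((u x / U) powr (1 - c) * (v x / V) powr c) = u x powr (1 - c) * v x powr c"
        using pos \<open>u x > 0\<close> \<open>v x > 0\<close> by (simp add: K_def powr_divide)
      ultimately show ?thesis by simp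
    qed
    have "(\<integral>\<^sup>+x. ennreal (u x powr (1 - c) * v x powr c) \<partial>M)
        \<le> (\<integral>\<^sup>+x. ennreal (K * ((1 - c) * (u x / U) + c * (v x / V))) \<partial>M)"
      by (intro nn_integral_mono ennreal_leI pw)
    also have "\<dots> = ennreal (\<integral>x. K * ((1 - c) * (u x / U) + c * (v x / V)) \<partial>M)"
      using u v c pos
      by (intro nn_integral_eq_integral) (auto simp: K_def intro!: AE_I2 mult_nonneg_nonneg add_nonneg_nonneg)
    also have "(\<integral>x. K * ((1 - c) * (u x / U) + c * (v x / V)) \<partial>M)
        = K * ((1 - c) * (U / U) + c * (V / V))"
      using u(1) v(1) by (simp add: U_def V_def)
    also have "\<dots> = K" using pos by simp
    finally show ?thesis by (simp add: K_def U_def V_def)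
  qed
qed

section \<open>The inequality for densities\<close>

lemma ennreal_power2_le_imp_le:
  fixes x :: ennreal
  assumes "x\<^sup>2 \<le> (ennreal s)\<^sup>2" "0 \<le> s"
  shows "x \<le> ennreal s"
proof (cases x)
  case (real r)
  with assms have "r\<^sup>2 \<le> s\<^sup>2" by (simp add: ennreal_power)
  with real \<open>0 \<le> s\<close> show ?thesis by (auto intro: ennreal_leI power2_le_imp_le)
next
  case top
  with assms show ?thesis by (simp add: ennreal_power top_power_ennreal top_unique)
qed

text \<open>
  The exponent \<open>p\<close> is determined by \<open>p (1 - c) = 2\<close> with \<open>c = max 0 (2 - a)\<close>: it is the order at which
  Hoelder's inequality for \<open>w\<^sup>2 (1 + f) powr c\<close> leaves the first power of \<open>1 + f\<close>, whose integral
  does not depend on \<open>f\<close>.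
\<close>
lemma (in prob_space) weighted_L1_le_powr_divergence:
  fixes w f :: "'a \<Rightarrow> real"
  assumes [measurable]: "w \<in> borel_measurable M" "f \<in> borel_measurable M"
    and w: "\<And>x. x \<in> space M \<Longrightarrow> 0 \<le> w x"
    and f: "\<And>x. 0 \<le> f x" "integrable M f" "(\<integral>x. f x \<partial>M) = 1"
    and a: "a > 1" and p: "p = max 2 (2 / (a - 1))"
    and wp: "integrable M (\<lambda>x. w x powr p)"
    and fa: "integrable M (\<lambda>x. f x powr a)"
  shows "(\<integral>\<^sup>+x. ennreal (w x * \<bar>f x - 1\<bar>) \<partial>M)
    \<le> ennreal (2 * (\<integral>x. w x powr p \<partial>M) powr (1 / p) * sqrt (((\<integral>x. f x powr a \<partial>M) - 1) / (a - 1)))"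
proof -
  define c where "c = max 0 (2 - a)"
  have c: "0 \<le> c" "c < 1" using a by (auto simp: c_def)
  have pc: "p * (1 - c) = 2" using a by (auto simp: p c_def max_def field_simps)
  then have "p > 0" using c by (smt (verit) mult_nonpos_nonneg)
  define W where "W = (\<integral>x. w x powr p \<partial>M)"
  define T where "T = ((\<integral>x. f x powr a \<partial>M) - 1) / (a - 1)"
  define g where "g x = (f x powr a - 1 - a * (f x - 1)) / (a - 1)" for x
  have "W \<ge> 0" unfolding W_def by simp
  have sq: "(f x - 1)\<^sup>2 \<le> 2 * (1 + f x) powr c * g x" for x
    unfolding c_def g_def using square_le_powr_generator[OF f(1) a] .
  have g0: "0 \<le> g x" for x
  proof -
    have "0 \<le> 2 * (1 + f x) powr c * g x" using sq[of x] by (smt (verit) zero_le_power2)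
    moreover have "0 < 2 * (1 + f x) powr c" using f(1)[of x] by simp
    ultimately show ?thesis by (simp add: zero_le_mult_iff)
  qed
  have gi: "integrable M g" unfolding g_def using fa f(2) by auto
  have gT: "(\<integral>x. g x \<partial>M) = T"
    unfolding g_def T_def using fa f(2,3) by (simp add: prob_space)
  then have "T \<ge> 0" using g0 by (auto simp flip: gT intro!: integral_nonneg_AE)

  have first: "(\<integral>\<^sup>+x. (ennreal (w x * (1 + f x) powr (c / 2)))\<^sup>2 \<partial>M) \<le> ennreal (2 * W powr (1 - c))"
  proof -
    have "(\<integral>\<^sup>+x. (ennreal (w x * (1 + f x) powr (c / 2)))\<^sup>2 \<partial>M)
        = (\<integral>\<^sup>+x. ennreal ((w x powr p) powr (1 - c) * (1 + f x) powr c) \<partial>M)"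
    proof (intro nn_integral_cong)
      fix x assume "x \<in> space M"
      have "(w x powr p) powr (1 - c) = (w x)\<^sup>2"
        using w[OF \<open>x \<in> space M\<close>] pc by (simp add: powr_powr)
      moreover have "((1 + f x) powr (c / 2))\<^sup>2 = (1 + f x) powr c"
        by (simp add: power2_eq_square flip: powr_add)
      ultimately show "(ennreal (w x * (1 + f x) powr (c / 2)))\<^sup>2
          = ennreal ((w x powr p) powr (1 - c) * (1 + f x) powr c)"
        using w[OF \<open>x \<in> space M\<close>] by (simp add: ennreal_power power_mult_distrib)
    qed
    also have "\<dots> \<le> ennreal (W powr (1 - c) * (\<integral>x. 1 + f x \<partial>M) powr c)"
      unfolding W_def using wp f(1,2) c by (intro nn_integral_Holder_powr) auto
    also have "(\<integral>x. 1 + f x \<partial>M) = 2" using f(2,3) by (simp add: prob_space)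
    also have "ennreal (W powr (1 - c) * 2 powr c) \<le> ennreal (2 * W powr (1 - c))"
    proof (rule ennreal_leI)
      have "(2::real) powr c \<le> 2 powr 1" using c by (intro powr_mono) auto
      then have "W powr (1 - c) * 2 powr c \<le> W powr (1 - c) * 2"
        by (intro mult_left_mono) auto
      then show "W powr (1 - c) * 2 powr c \<le> 2 * W powr (1 - c)" by (simp add: mult.commute)
    qed
    finally show ?thesis .
  qed

  have second: "(\<integral>\<^sup>+x. (ennreal (\<bar>f x - 1\<bar> * (1 + f x) powr (- (c / 2))))\<^sup>2 \<partial>M) \<le> ennreal (2 * T)"
  proof -
    have "(\<integral>\<^sup>+x. (ennreal (\<bar>f x - 1\<bar> * (1 + f x) powr (- (c / 2))))\<^sup>2 \<partial>M)
        \<le> (\<integral>\<^sup>+x. ennreal (2 * g x) \<partial>M)"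
    proof (intro nn_integral_mono)
      fix x
      have "(\<bar>f x - 1\<bar> * (1 + f x) powr (- (c / 2)))\<^sup>2 = (f x - 1)\<^sup>2 * (1 + f x) powr (- c)"
      proof -
        have "((1 + f x) powr (- (c / 2)))\<^sup>2 = (1 + f x) powr (- c)"
          by (simp add: power2_eq_square flip: powr_add)
        then show ?thesis by (simp add: power_mult_distrib)
      qed
      also have "\<dots> \<le> 2 * (1 + f x) powr c * g x * (1 + f x) powr (- c)"
        using sq[of x] by (intro mult_right_mono) auto
      also have "\<dots> = 2 * g x * ((1 + f x) powr c * (1 + f x) powr (- c))" by (simp only: mult_ac)
      also have "\<dots> = 2 * g x" using f(1)[of x] by (simp flip: powr_add)
      finally show "(ennreal (\<bar>f x - 1\<bar> * (1 + f x) powr (- (c / 2))))\<^sup>2 \<le> ennreal (2 * g x)"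
        by (simp add: ennreal_power ennreal_leI)
    qed
    also have "\<dots> = ennreal (\<integral>x. 2 * g x \<partial>M)"
      using gi g0 by (intro nn_integral_eq_integral) auto
    finally show ?thesis by (simp add: gT)
  qed

  have "(\<integral>\<^sup>+x. ennreal (w x * \<bar>f x - 1\<bar>) \<partial>M)
      = (\<integral>\<^sup>+x. ennreal (w x * (1 + f x) powr (c / 2)) * ennreal (\<bar>f x - 1\<bar> * (1 + f x) powr (- (c / 2))) \<partial>M)"
  proof (intro nn_integral_cong)
    fix x assume "x \<in> space M"
    have "(1 + f x) powr (c / 2) * (1 + f x) powr (- (c / 2)) = 1"
      using f(1)[of x] by (simp flip: powr_add)
    then have "w x * \<bar>f x - 1\<bar>
        = (w x * (1 + f x) powr (c / 2)) * (\<bar>f x - 1\<bar> * (1 + f x) powr (- (c / 2)))"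
      by (simp add: mult_ac)
    then show "ennreal (w x * \<bar>f x - 1\<bar>)
        = ennreal (w x * (1 + f x) powr (c / 2)) * ennreal (\<bar>f x - 1\<bar> * (1 + f x) powr (- (c / 2)))"
      using w[OF \<open>x \<in> space M\<close>] by (simp flip: ennreal_mult)
  qed
  then have "(\<integral>\<^sup>+x. ennreal (w x * \<bar>f x - 1\<bar>) \<partial>M)\<^sup>2
      \<le> (\<integral>\<^sup>+x. (ennreal (w x * (1 + f x) powr (c / 2)))\<^sup>2 \<partial>M) *
        (\<integral>\<^sup>+x. (ennreal (\<bar>f x - 1\<bar> * (1 + f x) powr (- (c / 2))))\<^sup>2 \<partial>M)"
    using Cauchy_Schwarz_nn_integral[of "\<lambda>x. ennreal (w x * (1 + f x) powr (c / 2))" M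
        "\<lambda>x. ennreal (\<bar>f x - 1\<bar> * (1 + f x) powr (- (c / 2)))"] by simp
  also have "\<dots> \<le> ennreal (2 * W powr (1 - c)) * ennreal (2 * T)"
    by (intro mult_mono first second) auto
  also have "\<dots> = (ennreal (2 * W powr (1 / p) * sqrt T))\<^sup>2"
  proof -
    have "1 - c = 1 / p + 1 / p" using pc \<open>p > 0\<close> by (simp add: field_simps)
    then have "W powr (1 - c) = (W powr (1 / p))\<^sup>2"
      by (simp only: power2_eq_square powr_add)
    then show ?thesis
      using \<open>T \<ge> 0\<close> by (simp add: ennreal_power power_mult_distrib flip: ennreal_mult)
  qed
  finally have "(\<integral>\<^sup>+x. ennreal (w x * \<bar>f x - 1\<bar>) \<partial>M) \<le> ennreal (2 * W powr (1 / p) * sqrt T)"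
    using \<open>T \<ge> 0\<close> by (intro ennreal_power2_le_imp_le) auto
  then show ?thesis by (simp add: W_def T_def)
qed

section \<open>The total variation measure\<close>

text \<open>
  On each cell of a partition the difference of the measures is the integral of \<open>f - 1\<close>, and these
  integrals are at most the integrals of \<open>\<bar>f - 1\<bar>\<close>, which add up. This bounds the set function from
  which \<open>total_variation_diff\<close> is built, and the measure made from it by \<open>measure_of\<close> is either that set
  function or zero.
\<close>
lemma total_variation_diff_le_density:
  fixes f :: "'a \<Rightarrow> real"
  assumes f: "integrable M f" "\<And>x. 0 \<le> f x" and "finite_measure M"
    and N: "N = density M (\<lambda>x. ennreal (f x))"
  shows "total_variation_diff N M \<le> density M (\<lambda>x. ennreal \<bar>f x - 1\<bar>)"
proof -
  interpret finite_measure M by fact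
  have [measurable]: "f \<in> borel_measurable M" using f(1) by auto
  let ?D = "density M (\<lambda>x. ennreal \<bar>f x - 1\<bar>)"
  have one: "ennreal \<bar>measure N B - measure M B\<bar> \<le> emeasure ?D B" if B[measurable]: "B \<in> sets M" for B
  proof -
    have fB: "integrable M (\<lambda>x. f x * indicator B x)"
      using f(1) B by (intro integrable_real_mult_indicator)
    have iB: "integrable M (\<lambda>x. indicator B x :: real)"
      using B by (intro integrable_real_indicator) (simp_all flip: less_top)
    have "measure N B = (\<integral>x. f x * indicator B x \<partial>M)"
    proof -
      have "emeasure N B = (\<integral>\<^sup>+x. ennreal (f x * indicator B x) \<partial>M)"
        unfolding N by (subst emeasure_density) (auto intro!: nn_integral_cong split: split_indicator)
      also have "\<dots> = ennreal (\<integral>x. f x * indicator B x \<partial>M)"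
        using fB f(2) by (intro nn_integral_eq_integral) auto
      finally show ?thesis
        using f(2) by (simp add: measure_def integral_nonneg_AE)
    qed
    moreover have "measure M B = (\<integral>x. indicator B x \<partial>M)" using B by simp
    ultimately have "measure N B - measure M B = (\<integral>x. f x * indicator B x - indicator B x \<partial>M)"
      using fB iB by simp
    then have "ennreal \<bar>measure N B - measure M B\<bar> \<le> (\<integral>\<^sup>+x. ennreal \<bar>f x * indicator B x - indicator B x\<bar> \<partial>M)"
      using integral_norm_bound_ennreal[of M "\<lambda>x. f x * indicator B x - indicator B x"] fB iB by simp
    also have "\<dots> = emeasure ?D B"
      by (subst emeasure_density) (auto intro!: nn_integral_cong split: split_indicator)
    finally show ?thesis .
  qed
  have sup: "(SUP P \<in> {P. finite P \<and> P \<subseteq> sets M \<and> partition_on A P}.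
      \<Sum>B\<in>P. ennreal \<bar>measure N B - measure M B\<bar>) \<le> emeasure ?D A" for A
  proof (rule SUP_least)
    fix P assume P: "P \<in> {P. finite P \<and> P \<subseteq> sets M \<and> partition_on A P}"
    then have "(\<Sum>B\<in>P. ennreal \<bar>measure N B - measure M B\<bar>) \<le> (\<Sum>B\<in>P. emeasure ?D B)"
      by (intro sum_mono one) auto
    also have "\<dots> = emeasure ?D (\<Union>B\<in>P. B)"
      using P by (intro sum_emeasure)
        (auto simp: partition_on_def disjoint_family_on_def disjoint_def)
    also have "(\<Union>B\<in>P. B) = A" using P by (auto simp: partition_on_def)
    finally show "(\<Sum>B\<in>P. ennreal \<bar>measure N B - measure M B\<bar>) \<le> emeasure ?D A" .
  qed
  have "sets (total_variation_diff N M) = sets ?D" "space (total_variation_diff N M) = space ?D"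
    by (simp_all add: total_variation_diff_def)
  moreover have "emeasure (total_variation_diff N M) \<le> emeasure ?D"
    unfolding total_variation_diff_def emeasure_measure_of_conv using sup
    by (auto simp: le_fun_def)
  ultimately show ?thesis by (simp add: less_eq_measure.simps)
qed

lemma weighted_TV_le_density:
  fixes f :: "'a \<Rightarrow> real"
  assumes f: "integrable M f" "\<And>x. 0 \<le> f x" and "finite_measure M"
    and N: "N = density M (\<lambda>x. ennreal (f x))"
    and [measurable]: "w \<in> borel_measurable M"
  shows "weighted_TV w N M \<le> (\<integral>\<^sup>+x. ennreal (w x * \<bar>f x - 1\<bar>) \<partial>M)"
proof -
  have [measurable]: "f \<in> borel_measurable M" using f(1) by auto
  have "weighted_TV w N M \<le> (\<integral>\<^sup>+x. ennreal (w x) \<partial>density M (\<lambda>x. ennreal \<bar>f x - 1\<bar>))"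
    unfolding weighted_TV_def using total_variation_diff_le_density[OF assms(1-4)]
    by (intro nn_integral_mono_measure) (auto simp: total_variation_diff_def)
  also have "\<dots> = (\<integral>\<^sup>+x. ennreal (w x * \<bar>f x - 1\<bar>) \<partial>M)"
    by (subst nn_integral_density)
      (auto intro!: nn_integral_cong simp: ennreal_mult'' mult.commute)
  finally show ?thesis .
qed

section \<open>The weighted Pinsker inequality\<close>

theorem theorem2p2:
  fixes \<mu> :: "'a measure" and w :: "'a \<Rightarrow> real" and \<alpha> \<beta> \<beta>' C :: real
  assumes "prob_space \<mu>"
    and "w \<in> borel_measurable \<mu>"
    and "\<And>x. x \<in> space \<mu> \<Longrightarrow> 0 \<le> w x"
    and "\<alpha> > 1"
    and "\<beta> = \<alpha> / (\<alpha> - 1)"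
    and "\<beta>' = max \<beta> 2"
    and "C = (if \<alpha> \<ge> 2 then 2 else 4 * \<beta> powr \<beta>)"
  shows "\<forall>\<nu> :: 'a measure. prob_space \<nu> \<and> sets \<nu> = sets \<mu> \<longrightarrow>
           weighted_TV w \<nu> \<mu> \<le> bound_rhs C (Lp_norm (2 * \<beta>' - 2) \<mu> w) (renyi_power \<alpha> \<nu> \<mu>)"
proof (intro allI impI, elim conjE)
  fix \<nu> :: "'a measure"
  assume "prob_space \<nu>" and sets: "sets \<nu> = sets \<mu>"
  interpret prob_space \<mu> by fact
  interpret N: prob_space \<nu> by fact
  note [measurable] = \<open>w \<in> borel_measurable \<mu>\<close>
  define p where "p = 2 * \<beta>' - 2"
  have "2 * \<beta> - 2 = 2 / (\<alpha> - 1)"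
    using \<open>\<alpha> > 1\<close> by (simp add: \<open>\<beta> = _\<close> field_simps)
  then have p: "p = max 2 (2 / (\<alpha> - 1))"
    by (auto simp: p_def \<open>\<beta>' = _\<close> max_def)
  have "C \<ge> 2"
  proof (cases "\<alpha> \<ge> 2")
    case False
    then have "\<beta> \<ge> 1" using \<open>\<alpha> > 1\<close> by (simp add: \<open>\<beta> = _\<close> field_simps)
    then have "\<beta> powr \<beta> \<ge> 1" by (intro ge_one_powr_ge_zero) auto
    with False show ?thesis by (simp add: \<open>C = _\<close>)
  qed (simp add: \<open>C = _\<close>)
  show "weighted_TV w \<nu> \<mu> \<le> bound_rhs C (Lp_norm (2 * \<beta>' - 2) \<mu> w) (renyi_power \<alpha> \<nu> \<mu>)"
  proof (cases "Lp_norm p \<mu> w = \<infinity> \<or> renyi_power \<alpha> \<nu> \<mu> = \<infinity>")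
    case True
    then show ?thesis by (simp add: bound_rhs_def p_def)
  next
    case False
    define f where "f x = enn2real (RN_deriv \<mu> \<nu> x)" for x
    have f0: "0 \<le> f x" for x
      by (simp add: f_def)
    have [measurable]: "f \<in> borel_measurable \<mu>"
      unfolding f_def by measurable
    have ac: "absolutely_continuous \<mu> \<nu>"
      using False by (auto simp: renyi_power_def split: if_splits)
    have fin: "AE x in \<mu>. RN_deriv \<mu> \<nu> x = ennreal (f x)"
      using RN_deriv_finite[OF N.sigma_finite_measure_axioms ac sets]
      by eventually_elim (auto simp: f_def less_top)
    have \<nu>: "\<nu> = density \<mu> (\<lambda>x. ennreal (f x))"
      using density_RN_deriv[OF ac sets] density_cong[OF _ _ fin] by simp
    have nn1: "(\<integral>\<^sup>+x. ennreal (f x) \<partial>\<mu>) = 1"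
      using N.emeasure_space_1 by (simp add: \<nu> emeasure_density cong: nn_integral_cong)
    have fi: "integrable \<mu> f"
      using nn1 f0 by (intro integrableI_nonneg) auto
    have f1: "(\<integral>x. f x \<partial>\<mu>) = 1"
      using nn1 f0 by (simp add: integral_eq_nn_integral)
    have fa: "integrable \<mu> (\<lambda>x. f x powr \<alpha>)"
    proof (intro integrableI_nonneg)
      show "(\<integral>\<^sup>+x. ennreal (f x powr \<alpha>) \<partial>\<mu>) < \<infinity>"
      proof (rule ccontr)
        assume "\<not> ?thesis"
        then have "(\<integral>\<^sup>+x. ennreal (f x powr \<alpha>) \<partial>\<mu>) = \<infinity>" by (simp flip: less_top)
        then have "renyi_power \<alpha> \<nu> \<mu> = \<infinity>"
          using ac \<open>\<alpha> > 1\<close> by (simp add: renyi_power_def f_def)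
        with False show False by simp
      qed
    qed auto
    have T: "renyi_power \<alpha> \<nu> \<mu> = ereal (((\<integral>x. f x powr \<alpha> \<partial>\<mu>) - 1) / (\<alpha> - 1))"
    proof -
      have "(\<integral>\<^sup>+x. ennreal (enn2real (RN_deriv \<mu> \<nu> x) powr \<alpha>) \<partial>\<mu>) = ennreal (\<integral>x. f x powr \<alpha> \<partial>\<mu>)"
        using fa unfolding f_def by (intro nn_integral_eq_integral) auto
      moreover have "0 \<le> (\<integral>x. f x powr \<alpha> \<partial>\<mu>)" by simp
      ultimately show ?thesis
        using ac by (simp add: renyi_power_def one_ereal_def)
    qed
    have abs_w: "(\<integral>\<^sup>+x. ennreal (\<bar>w x\<bar> powr p) \<partial>\<mu>) = (\<integral>\<^sup>+x. ennreal (w x powr p) \<partial>\<mu>)"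
      using assms(3) by (intro nn_integral_cong) auto
    have wp: "integrable \<mu> (\<lambda>x. w x powr p)"
      using False abs_w by (intro integrableI_nonneg) (auto simp: Lp_norm_def Let_def simp flip: less_top split: if_splits)
    then have "(\<integral>\<^sup>+x. ennreal (w x powr p) \<partial>\<mu>) = ennreal (\<integral>x. w x powr p \<partial>\<mu>)"
      by (intro nn_integral_eq_integral) auto
    then have L: "Lp_norm p \<mu> w = ennreal ((\<integral>x. w x powr p \<partial>\<mu>) powr (1 / p))"
      by (simp add: Lp_norm_def abs_w)
    have "weighted_TV w \<nu> \<mu> \<le> (\<integral>\<^sup>+x. ennreal (w x * \<bar>f x - 1\<bar>) \<partial>\<mu>)"
      by (rule weighted_TV_le_density[OF fi f0 finite_measure_axioms \<nu>]) simp
    also have "\<dots> \<le> ennreal (2 * (\<integral>x. w x powr p \<partial>\<mu>) powr (1 / p)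
        * sqrt (((\<integral>x. f x powr \<alpha> \<partial>\<mu>) - 1) / (\<alpha> - 1)))"
      using assms(3) f0 fi f1 \<open>\<alpha> > 1\<close> p wp fa by (intro weighted_L1_le_powr_divergence) auto
    also have "\<dots> \<le> ennreal (C * (\<integral>x. w x powr p \<partial>\<mu>) powr (1 / p)
        * sqrt (((\<integral>x. f x powr \<alpha> \<partial>\<mu>) - 1) / (\<alpha> - 1)))"
    proof (cases "((\<integral>x. f x powr \<alpha> \<partial>\<mu>) - 1) / (\<alpha> - 1) \<ge> 0")
      case True
      then show ?thesis using \<open>C \<ge> 2\<close> by (intro ennreal_leI mult_right_mono) auto
    next
      \<comment> \<open>The real square root is an odd function, so for a negative radicand \<open>ennreal\<close> truncates
        both sides to \<open>0\<close>.\<close>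
      case False
      then show ?thesis by (simp add: ennreal_neg mult_nonneg_nonpos)
    qed
    finally show ?thesis
      using False unfolding p_def[symmetric] by (simp add: bound_rhs_def L T)
  qed
qed

end
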